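(* Let $T:[1,\infty)\to[1,\infty)$, $T(t)=\dfrac1{1+\lfloor t\rfloor-t}$, and let $F:[0,1)\to[0,1)$, $F(s)=\dfrac1{1-s}\pmod 1$ (the backward continued fraction map). The dynamical system $([1,\infty),T)$ is topologically conjugate to $([0,1),F)$, with conjugacy $\phi:[1,\infty)\to[0,1)$ given by $\phi(t)=1-\frac1t$. As a consequence, the map $T$ preserves the infinite measure $d\mu(t)=\dfrac{dt}{t(t-1)}$ on $[1,\infty)$. In particular, if $t\in\mathbb{Q}$, $t\ge1$, there exists $k_t\ge0$ such that $T^{k_t}(t)=1$, and therefore $T^k(t)=1$ for all $k\ge k_t$.
   Context: Topological conjugacy means that $\phi$ is a homeomorphism with $\phi\circ T=F\circ\phi$. $\lfloor t\rfloor$ is the integer part of $t$. *)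

theory Defs
  imports "HOL-Analysis.Analysis"
begin

text \<open>Continuity of the maps is not required (the ones below jump): a dynamical system is just a self-map
  of a set \<open>X\<close> carrying its subspace topology.\<close>

definition conjugacy_between ::
  "'a::topological_space set \<Rightarrow> ('a \<Rightarrow> 'a) \<Rightarrow> 'b::topological_space set \<Rightarrow> ('b \<Rightarrow> 'b) \<Rightarrow> ('a \<Rightarrow> 'b) \<Rightarrow> bool"
  where "conjugacy_between X T Y F \<phi> \<longleftrightarrow>
    T \<in> X \<rightarrow> X \<and> F \<in> Y \<rightarrow> Y \<and>
    (\<exists>\<psi>. homeomorphism X Y \<phi> \<psi>) \<and> (\<forall>x\<in>X. \<phi> (T x) = F (\<phi> x))"

definition preserves_measure :: "('a \<Rightarrow> 'a) \<Rightarrow> 'a measure \<Rightarrow> bool"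
  where "preserves_measure T M \<longleftrightarrow>
    T \<in> M \<rightarrow>\<^sub>M M \<and> (\<forall>A\<in>sets M. emeasure M (T -` A \<inter> space M) = emeasure M A)"

definition T_map :: "real \<Rightarrow> real"
  where "T_map t = 1 / (1 + real_of_int \<lfloor>t\<rfloor> - t)"

definition bcf_map :: "real \<Rightarrow> real"
  where "bcf_map s = frac (1 / (1 - s))"

definition conj_map :: "real \<Rightarrow> real"
  where "conj_map t = 1 - 1 / t"

text \<open>A measure on the Borel subsets of \<open>[1,\<infinity>)\<close>.  At \<open>t = 1\<close> the density has a pole and
  takes the value \<open>1 / 0 = 0\<close>; this is harmless because \<open>{1}\<close> is a Lebesgue null set.\<close>

definition T_measure :: "real measure"
  where "T_measure = density (restrict_space lborel {1..}) (\<lambda>t. ennreal (1 / (t * (t - 1))))"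

end

theory Submission
  imports Defs
begin

text \<open>Both \<open>\<phi> \<circ> T\<close> and \<open>F \<circ> \<phi>\<close> are the fractional part. The density \<open>1 / (t (t - 1))\<close> has the
  primitive \<open>ln (1 - 1 / t)\<close>, and the preimage of a ray \<open>(y, \<infinity>)\<close> is the disjoint union of the
  intervals \<open>(n - 1 / y, n)\<close> with \<open>n \<ge> 2\<close>, whose measures telescope to the measure of the ray.
  Finally, \<open>T\<close> strictly lowers the denominator of a rational number that is not an integer.\<close>

section \<open>Elementary properties of T and the conjugacy\<close>

lemma T_map_eq: "T_map t = 1 / (1 - frac t)"
  by (simp add: T_map_def frac_def)

lemma T_map_ge_1: "1 \<le> T_map t"
  using frac_ge_0[of t] frac_lt_1[of t] by (simp add: T_map_eq)

lemma T_map_Ints: "t \<in> \<int> \<Longrightarrow> T_map t = 1"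
  by (simp add: T_map_eq frac_eq_0_iff[THEN iffD2])

text \<open>The denominator 1 - frac t lies in (0,1] and equals 1 only for integral t. Hence the
  preimage of the complement of (1,\<infinity>) is countable.\<close>

lemma T_map_le_1_iff: "T_map t \<le> 1 \<longleftrightarrow> t \<in> \<int>"
  using frac_ge_0[of t] frac_lt_1[of t] unfolding frac_eq_0_iff[symmetric]
  by (auto simp: T_map_eq divide_simps simp del: frac_eq_0_iff intro: antisym)

lemma T_map_measurable [measurable]: "T_map \<in> borel_measurable borel"
  unfolding T_map_def by measurable

lemma homeomorphism_conj_map:
  "homeomorphism {1..} {0..<1} conj_map (\<lambda>s. 1 / (1 - s))"
proof (rule homeomorphismI)
  show "continuous_on {1..} conj_map"
    unfolding conj_map_def by (intro continuous_intros) auto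
  show "continuous_on {0..<1} (\<lambda>s. 1 / (1 - s) :: real)"
    by (intro continuous_intros) auto
qed (auto simp: conj_map_def divide_simps)

lemma conj_map_T_map: "t \<noteq> 0 \<Longrightarrow> conj_map (T_map t) = bcf_map (conj_map t)"
  by (simp add: conj_map_def bcf_map_def T_map_eq)

lemma conjugacy_T_map_bcf_map: "conjugacy_between {1..} T_map {0..<1} bcf_map conj_map"
  unfolding conjugacy_between_def
  using homeomorphism_conj_map conj_map_T_map T_map_ge_1
  by (auto simp: bcf_map_def frac_ge_0 frac_lt_1)

section \<open>Orbits of rational numbers\<close>

lemma T_map_funpow_one: "(T_map ^^ k) 1 = 1"
  by (induction k) (auto simp: T_map_Ints)

text \<open>With r = p mod q one has T(p/q) = q/(q - r), whose denominator lies strictly between 0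
  and q unless r = 0. Fractions need not be reduced, and \<open>p\<close> stays arbitrary because q
  becomes the next numerator.\<close>

lemma T_map_funpow_Rats:
  assumes "0 < q"
  shows "\<exists>k. (T_map ^^ k) (real_of_int p / real q) = 1"
  using assms
proof (induction q arbitrary: p rule: less_induct)
  case (less q)
  define r where "r = p mod int q"
  have r: "0 \<le> r" "r < int q"
    using less.prems by (auto simp: r_def)
  have "frac (real_of_int p / real q) = real_of_int r / real q"
    unfolding r_def using less.prems
    by (simp add: frac_def floor_divide_of_int_eq[of p "int q", simplified]
        minus_div_mult_eq_mod[symmetric] field_simps)
  then have "T_map (real_of_int p / real q) = 1 / (1 - real_of_int r / real q)"
    by (simp only: T_map_eq)
  then have T: "T_map (real_of_int p / real q) = real_of_int (int q) / real (nat (int q - r))"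
    using r less.prems by (simp add: field_simps)
  show ?case
  proof (cases "r = 0")
    case True
    then have "(T_map ^^ 1) (real_of_int p / real q) = 1"
      using T less.prems by simp
    then show ?thesis by blast
  next
    case False
    then have "0 < nat (int q - r)" "nat (int q - r) < q"
      using r by linarith+
    then obtain k where "(T_map ^^ k) (real_of_int (int q) / real (nat (int q - r))) = 1"
      using less.IH by blast
    then have "(T_map ^^ Suc k) (real_of_int p / real q) = 1"
      by (simp only: funpow_Suc_right o_apply T)
    then show ?thesis by blast
  qed
qed

lemma T_map_eventually_one:
  assumes "t \<in> \<rat>"
  shows "\<exists>k\<^sub>t. (T_map ^^ k\<^sub>t) t = 1 \<and> (\<forall>k\<ge>k\<^sub>t. (T_map ^^ k) t = 1)"
proof -
  obtain p :: int and q :: int where "0 < q" "t = real_of_int p / real_of_int q"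
    using assms by (metis Rats_cases')
  then obtain k where k: "(T_map ^^ k) t = 1"
    using T_map_funpow_Rats[of "nat q" p] by auto
  have "(T_map ^^ m) t = 1" if "k \<le> m" for m
    using that k T_map_funpow_one by (metis comp_apply funpow_add le_add_diff_inverse2)
  with k show ?thesis by blast
qed

section \<open>Determining a measure by its values on rays\<close>

lemma emeasure_eq_SUP_greaterThan:
  fixes M :: "real measure"
  assumes [simp]: "sets M = sets borel" and "emeasure M {..a} = 0" and A: "A \<in> sets borel"
  shows "emeasure M A = (SUP i::nat. emeasure M ({a + 1 / real (Suc i)<..} \<inter> A))"
proof -
  let ?C = "\<lambda>i::nat. {a + 1 / real (Suc i)<..}"
  have [measurable]: "A \<in> sets M"
    using A by simp
  have "(\<Union>i. ?C i) = {a<..}"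
  proof (intro equalityI subsetI)
    fix x assume "x \<in> {a<..}"
    then show "x \<in> (\<Union>i. ?C i)"
      using reals_Archimedean[of "x - a"] by (auto simp: inverse_eq_divide algebra_simps)
  next
    fix x assume "x \<in> (\<Union>i. ?C i)"
    then obtain i :: nat where "a + 1 / real (Suc i) < x" by auto
    moreover have "0 < 1 / real (Suc i)" by simp
    ultimately show "x \<in> {a<..}"
      unfolding greaterThan_iff by linarith
  qed
  then have "{a<..} \<inter> A = (\<Union>i. ?C i \<inter> A)"
    by blast
  moreover have "incseq (\<lambda>i. ?C i \<inter> A)"
    by (rule incseq_SucI) (auto simp: field_simps intro: order_le_less_trans[rotated])
  ultimately have "(SUP i. emeasure M (?C i \<inter> A)) = emeasure M ({a<..} \<inter> A)"
    by (subst SUP_emeasure_incseq) (auto simp: A)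
  also have "\<dots> = emeasure M A"
  proof (rule emeasure_eq_AE)
    have "AE x in M. x \<notin> {..a}"
      using assms(2) by (intro AE_not_in) (auto simp: null_sets_def)
    then show "AE x in M. x \<in> {a<..} \<inter> A \<longleftrightarrow> x \<in> A"
      by eventually_elim auto
  qed (auto simp: A)
  finally show ?thesis by simp
qed

text \<open>Uniqueness from rays via \<open>measure_eqI_lessThan\<close> needs all rays to have
  finite measure, which fails for a measure that is infinite near a. So both measures are first cut
  to (c,\<infinity>) with c > a, and then c decreases to a by continuity from below.\<close>

lemma measure_eqI_greaterThan_above:
  fixes M N :: "real measure"
  assumes sets [simp]: "sets M = sets borel" "sets N = sets borel"
    and null: "emeasure M {..a} = 0" "emeasure N {..a} = 0"
    and fin: "\<And>x. a < x \<Longrightarrow> emeasure M {x<..} < \<infinity>"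
    and eq: "\<And>x. a < x \<Longrightarrow> emeasure M {x<..} = emeasure N {x<..}"
  shows "M = N"
proof (rule measure_eqI)
  fix A assume "A \<in> sets M"
  then have A: "A \<in> sets borel" by simp
  have cut: "emeasure M ({c<..} \<inter> A) = emeasure N ({c<..} \<inter> A)" if c: "a < c" for c
  proof -
    have *: "{c<..} \<inter> {x<..} = {max c x<..}" for x by auto
    \<comment> \<open>A ray of the cut measure starts at max c x > a, where finiteness and equality
      are assumed.\<close>
    have "density M (indicator {c<..}) = density N (indicator {c<..})"
      using c fin[of "max c _"] eq[of "max c _"]
      by (intro measure_eqI_lessThan) (auto simp: emeasure_restricted * less_max_iff_disj)
    then have "emeasure (density M (indicator {c<..})) A = emeasure (density N (indicator {c<..})) A"
      by simp
    then show ?thesis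
      using A by (simp add: emeasure_restricted)
  qed
  show "emeasure M A = emeasure N A"
    by (simp add: emeasure_eq_SUP_greaterThan[where a = a] null A cut)
qed simp

section \<open>The measure of intervals\<close>

definition T_density :: "real \<Rightarrow> ennreal"
  where "T_density t = ennreal (1 / (t * (t - 1))) * indicator {1..} t"

text \<open>\<open>T_measure\<close> extended by zero to the Borel sets of the real line.\<close>

definition T_ext :: "real measure"
  where "T_ext = density lborel T_density"

lemma T_density_measurable [measurable]: "T_density \<in> borel_measurable borel"
  unfolding T_density_def by measurable

lemma sets_T_ext [measurable_cong, simp]: "sets T_ext = sets borel"
  by (simp add: T_ext_def)

lemma space_T_ext [simp]: "space T_ext = UNIV"
  by (simp add: T_ext_def)

lemma T_measure_eq: "T_measure = restrict_space T_ext {1..}"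
proof (rule measure_eqI)
  fix A assume "A \<in> sets T_measure"
  then have "A \<in> sets borel" "A \<subseteq> {1..}"
    by (auto simp: T_measure_def sets_restrict_space_iff)
  then show "emeasure T_measure A = emeasure (restrict_space T_ext {1..}) A"
    unfolding T_measure_def T_ext_def
    by (auto simp: emeasure_density emeasure_restrict_space sets_restrict_space_iff
        nn_integral_restrict_space T_density_def measurable_restrict_space1
        intro!: nn_integral_cong split: split_indicator)
qed (simp add: T_measure_def T_ext_def sets_restrict_space)

lemma T_ext_AE_ge: "AE t in T_ext. 1 \<le> t"
  unfolding T_ext_def by (subst AE_density) (auto simp: T_density_def indicator_def)

lemma T_ext_countable:
  assumes "countable A"
  shows "A \<in> null_sets T_ext"
proof -
  have "A \<in> null_sets lborel"
    using assms by (intro countable_imp_null_set_lborel)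
  then show ?thesis
    unfolding T_ext_def by (rule absolutely_continuousI_density[unfolded absolutely_continuous_def, THEN subsetD, rotated]) simp
qed

lemma T_ext_atLeast:
  assumes "1 < a"
  shows "emeasure T_ext {a..} = ennreal (- ln (1 - 1 / a))"
proof -
  have "emeasure T_ext {a..} = (\<integral>\<^sup>+t. ennreal (1 / (t * (t - 1))) * indicator {a..} t \<partial>lborel)"
    unfolding T_ext_def using assms
    by (subst emeasure_density) (auto simp: T_density_def intro!: nn_integral_cong split: split_indicator)
  also have "\<dots> = ennreal (0 - ln (1 - 1 / a))"
  proof (rule nn_integral_FTC_atLeast)
    fix t assume "a \<le> t"
    then show "((\<lambda>t. ln (1 - 1 / t)) has_real_derivative 1 / (t * (t - 1))) (at t)"
      using assms by (auto intro!: derivative_eq_intros simp: field_simps power2_eq_square)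
    show "0 \<le> 1 / (t * (t - 1))"
      using assms \<open>a \<le> t\<close> by simp
  next
    \<comment> \<open>The primitive vanishes at infinity, so the integral is minus its value at
      a.\<close>
    have "((\<lambda>t::real. ln (1 - 1 / t)) \<longlongrightarrow> ln (1 - 0)) at_top"
      by (intro tendsto_intros tendsto_divide_0[OF tendsto_const] filterlim_ident
          filterlim_at_top_imp_at_infinity) auto
    then show "((\<lambda>t::real. ln (1 - 1 / t)) \<longlongrightarrow> 0) at_top" by simp
  qed measurable
  finally show ?thesis by simp
qed

lemma T_ext_greaterThan:
  assumes "1 < a"
  shows "emeasure T_ext {a<..} = ennreal (- ln (1 - 1 / a))"
proof -
  have "{a<..} = {a..} - {a}" by auto
  then show ?thesis
    using T_ext_atLeast[OF assms] emeasure_Diff_null_set[OF T_ext_countable, of "{a}" "{a..}"] by simp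
qed

lemma T_ext_Ioo:
  assumes "1 < a" "a \<le> b"
  shows "emeasure T_ext {a<..<b} = ennreal (ln (1 - 1 / b) - ln (1 - 1 / a))"
proof (cases "a < b")
  case True
  have "{a<..<b} = {a<..} - {b..}" by auto
  moreover have "emeasure T_ext ({a<..} - {b..}) = emeasure T_ext {a<..} - emeasure T_ext {b..}"
    using assms True by (intro emeasure_Diff) (auto simp: T_ext_atLeast)
  ultimately show ?thesis
    using assms by (simp add: T_ext_atLeast T_ext_greaterThan ennreal_minus)
qed (use assms in auto)

section \<open>Invariance of the measure\<close>

text \<open>The condition says frac t > 1 - 1/y: t lies in the last piece, of length 1/y, of its
  unit interval. Since t is at least 1, the right end point floor t + 1 is at least 2, hence the
  shift by 2.\<close>

lemma T_map_greaterThan_iff: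
  assumes "1 < y" "1 \<le> t"
  shows "y < T_map t \<longleftrightarrow> (\<exists>n::nat. t \<in> {real n + 2 - 1 / y<..<real n + 2})"
proof -
  have iff: "y < T_map t \<longleftrightarrow> 1 - 1 / y < frac t"
    using assms frac_lt_1[of t] by (auto simp: T_map_eq field_simps)
  show ?thesis
  proof
    assume "y < T_map t"
    moreover have "1 \<le> \<lfloor>t\<rfloor>" using assms by simp
    ultimately show "\<exists>n::nat. t \<in> {real n + 2 - 1 / y<..<real n + 2}"
      unfolding iff using frac_lt_1[of t]
      by (intro exI[of _ "nat (\<lfloor>t\<rfloor> - 1)"]) (auto simp: frac_def)
  next
    assume "\<exists>n::nat. t \<in> {real n + 2 - 1 / y<..<real n + 2}"
    then obtain n :: nat where n: "real n + 2 - 1 / y < t" "t < real n + 2" by auto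
    moreover have "1 / y < 1" using assms by simp
    ultimately have "\<lfloor>t\<rfloor> = int n + 1" by (intro floor_unique) auto
    then show "y < T_map t"
      unfolding iff using n by (simp add: frac_def)
  qed
qed

lemma T_ext_vimage_greaterThan:
  assumes y: "1 < y"
  shows "emeasure T_ext (T_map -` {y<..}) = emeasure T_ext {y<..}"
proof -
  let ?I = "\<lambda>n::nat. {real n + 2 - 1 / y<..<real n + 2}"
  \<comment> \<open>Splitting ln (1 - 1/x) into ln (x - 1) - ln x at both ends of
    \<open>?I n\<close> turns its measure into \<open>?H n - ?H (Suc n)\<close>. The first term
    \<open>?H 0\<close> is the measure of the ray (y,\<infinity>).\<close>
  let ?H = "\<lambda>n::nat. ln (real n + 1) - ln (real n + 1 - 1 / y)"
  have y1: "0 < 1 / y" "1 / y < 1" using y by auto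
  have disj: "disjoint_family ?I"
  proof (unfold disjoint_family_on_def, intro ballI impI)
    fix m n :: nat assume "m \<noteq> n"
    then have "real m + 1 \<le> real n \<or> real n + 1 \<le> real m" by linarith
    then show "?I m \<inter> ?I n = {}"
    proof (elim disjE)
      assume "real m + 1 \<le> real n"
      then have "real m + 2 \<le> real n + 2 - 1 / y" using y1 by linarith
      then show ?thesis by auto
    next
      assume "real n + 1 \<le> real m"
      then have "real n + 2 \<le> real m + 2 - 1 / y" using y1 by linarith
      then show ?thesis by auto
    qed
  qed
  have meas: "emeasure T_ext (?I n) = ennreal (?H n - ?H (Suc n))" for n
  proof -
    have *: "ln (1 - 1 / x) = ln (x - 1) - ln x" if "1 < x" for x :: real
      using that ln_div[of "x - 1" x] by (simp add: diff_divide_distrib)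
    have less: "1 < real n + 2" "1 < real n + 2 - 1 / y" using y1 by linarith+
    have "emeasure T_ext (?I n) =
        ennreal (ln (1 - 1 / (real n + 2)) - ln (1 - 1 / (real n + 2 - 1 / y)))"
      using y1 less by (intro T_ext_Ioo) linarith+
    then show ?thesis
      unfolding less[THEN *] by (simp add: algebra_simps)
  qed
  \<comment> \<open>\<open>ennreal\<close> truncates negative reals to 0, so the real series
    transfers only if its terms are nonnegative. Exponentiating reduces this to an inequality of
    products, whose two sides differ by 1/y.\<close>
  have nonneg: "0 \<le> ?H n - ?H (Suc n)" for n
  proof -
    have "(real n + 2) * (real n + 1 - 1 / y) \<le> (real n + 1) * (real n + 2 - 1 / y)"
      using y1 by (simp add: algebra_simps)
    moreover have "0 < real n + 1 - 1 / y" using y1 by linarith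
    ultimately have "ln ((real n + 2) * (real n + 1 - 1 / y)) \<le> ln ((real n + 1) * (real n + 2 - 1 / y))"
      by (subst ln_le_cancel_iff) (auto intro!: mult_pos_pos)
    moreover have Suc: "real (Suc n) + 1 = real n + 2" by simp
    ultimately show ?thesis
      unfolding Suc using \<open>0 < real n + 1 - 1 / y\<close> ln_mult_pos[of "real n + 2" "real n + 1 - 1 / y"]
        ln_mult_pos[of "real n + 1" "real n + 2 - 1 / y"] by linarith
  qed
  \<comment> \<open>Here \<open>- ?H n\<close> is ln (1 - (1/y)/(n + 1)), which tends to ln
    1.\<close>
  have "?H \<longlonglongrightarrow> 0"
  proof -
    have "(\<lambda>n. ln (1 - (1 / y) / (real n + 1))) \<longlonglongrightarrow> ln (1 - 0)"
      using tendsto_mult[OF tendsto_const LIMSEQ_inverse_real_of_nat, of "1 / y"]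
      by (intro tendsto_intros) (auto simp: field_simps)
    moreover have "ln (1 - (1 / y) / (real n + 1)) = - ?H n" for n
    proof -
      have "0 < real n + 1 - 1 / y" using y1 by linarith
      then have "- ?H n = ln ((real n + 1 - 1 / y) / (real n + 1))" by (simp add: ln_div)
      also have "(real n + 1 - 1 / y) / (real n + 1) = 1 - (1 / y) / (real n + 1)"
        by (simp add: diff_divide_distrib)
      finally show ?thesis by simp
    qed
    ultimately have "(\<lambda>n. - ?H n) \<longlonglongrightarrow> 0" by simp
    then show ?thesis using tendsto_minus by fastforce
  qed
  from telescope_sums'[OF this] have sums: "(\<lambda>n. ?H n - ?H (Suc n)) sums (- ln (1 - 1 / y))"
    by simp
  \<comment> \<open>The two sets agree only on [1,\<infinity>): the preimage is taken in the whole
    line, where \<open>T_map\<close> is periodic. The points below 1 have measure 0.\<close>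
  have "emeasure T_ext (T_map -` {y<..}) = emeasure T_ext (\<Union>n. ?I n)"
  proof (rule emeasure_eq_AE)
    show "AE t in T_ext. t \<in> T_map -` {y<..} \<longleftrightarrow> t \<in> (\<Union>n. ?I n)"
      using T_ext_AE_ge by eventually_elim (use T_map_greaterThan_iff[OF y] in simp)
    show "T_map -` {y<..} \<in> sets T_ext"
      using measurable_sets[OF T_map_measurable, of "{y<..}"] by simp
  qed auto
  also have "\<dots> = (\<Sum>n. emeasure T_ext (?I n))"
    using disj by (intro suminf_emeasure[symmetric]) auto
  also have "\<dots> = ennreal (- ln (1 - 1 / y))"
    unfolding meas using nonneg sums by (rule suminf_ennreal_eq)
  finally show ?thesis
    using y by (simp add: T_ext_greaterThan)
qed

text \<open>Rays starting above 1 were treated in \<open>T_ext_vimage_greaterThan\<close>. On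
  (-\<infinity>,1] both measures vanish, because the preimage of this set is the set of integers, a
  null set.\<close>

lemma distr_T_ext: "distr T_ext borel T_map = T_ext"
proof (rule sym, rule measure_eqI_greaterThan_above[where a = 1])
  have "AE t in T_ext. t \<notin> {..1}"
    using T_ext_AE_ge AE_not_in[OF T_ext_countable[of "{1}"]] by (auto elim: eventually_elim2)
  then show "emeasure T_ext {..1} = 0"
    by (subst (asm) AE_iff_measurable[where N = "{..1}"]) auto
  have "T_map -` {..1} = \<int>"
    by (auto simp: T_map_le_1_iff)
  then show "emeasure (distr T_ext borel T_map) {..1} = 0"
    using T_ext_countable[OF countable_int] by (simp add: emeasure_distr null_setsD1)
qed (auto simp: emeasure_distr T_ext_vimage_greaterThan T_ext_greaterThan)

lemma sets_T_measure_iff: "A \<in> sets T_measure \<longleftrightarrow> A \<in> sets borel \<and> A \<subseteq> {1..}"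
  by (auto simp: T_measure_eq sets_restrict_space_iff)

lemma space_T_measure: "space T_measure = {1..}"
  by (simp add: T_measure_eq space_restrict_space)

lemma emeasure_T_measure: "A \<subseteq> {1..} \<Longrightarrow> emeasure T_measure A = emeasure T_ext A"
  by (simp add: T_measure_eq emeasure_restrict_space)

lemma preserves_measure_T_map: "preserves_measure T_map T_measure"
  unfolding preserves_measure_def
proof (intro conjI ballI)
  show "T_map \<in> T_measure \<rightarrow>\<^sub>M T_measure"
    unfolding T_measure_eq using T_map_ge_1
    by (intro measurable_restrict_space3) (auto simp: measurable_cong_sets[OF sets_T_ext sets_T_ext])
  fix A assume A: "A \<in> sets T_measure"
  then have [measurable]: "A \<in> sets borel" by (simp add: sets_T_measure_iff)
  have *: "T_map -` A \<in> sets borel"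
    using measurable_sets[OF T_map_measurable, of A] by simp
  have "emeasure T_measure (T_map -` A \<inter> space T_measure) = emeasure T_ext (T_map -` A \<inter> {1..})"
    by (simp add: emeasure_T_measure space_T_measure)
  \<comment> \<open>Intersecting with [1,\<infinity>) removes only a null set.\<close>
  also have "\<dots> = emeasure T_ext (T_map -` A)"
    using T_ext_AE_ge by (intro emeasure_eq_AE) (auto simp: *)
  also have "\<dots> = emeasure (distr T_ext borel T_map) A"
    by (simp add: emeasure_distr)
  also have "\<dots> = emeasure T_measure A"
    using A by (simp add: distr_T_ext emeasure_T_measure sets_T_measure_iff)
  finally show "emeasure T_measure (T_map -` A \<inter> space T_measure) = emeasure T_measure A" .
qed

section \<open>Infinite total mass\<close>

lemma emeasure_T_measure_space: "emeasure T_measure (space T_measure) = \<infinity>"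
proof -
  have "of_nat n \<le> emeasure T_ext {1..}" for n
  proof -
    \<comment> \<open>Solving - ln (1 - 1/a) = n + 1 makes [a,\<infinity>) a set of measure n + 1.
      Using \<open>Suc n\<close> keeps the denominator positive at n = 0. As n grows, a tends to 1,
      where the mass diverges.\<close>
    define a where "a = 1 / (1 - exp (- real (Suc n)))"
    have a: "1 < a" by (simp add: a_def)
    have "of_nat n \<le> ennreal (real (Suc n))"
      by (simp add: ennreal_of_nat_eq_real_of_nat)
    also have "real (Suc n) = - ln (1 - 1 / a)"
      by (simp add: a_def)
    also have "ennreal \<dots> = emeasure T_ext {a..}"
      using a by (simp add: T_ext_atLeast)
    also have "\<dots> \<le> emeasure T_ext {1..}"
      using a by (intro emeasure_mono) auto
    finally show ?thesis .
  qed
  then have "emeasure T_ext {1..} = \<infinity>"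
    by (metis ennreal_Ex_less_of_nat infinity_ennreal_def leD top.not_eq_extremum)
  then show ?thesis
    by (simp add: emeasure_T_measure space_T_measure)
qed

theorem proposition6p4:
  shows "conjugacy_between {1..} T_map {0..<1} bcf_map conj_map
    \<and> preserves_measure T_map T_measure
    \<and> emeasure T_measure (space T_measure) = \<infinity>
    \<and> (\<forall>t\<in>\<rat>. t \<ge> 1 \<longrightarrow>
         (\<exists>k\<^sub>t::nat. (T_map ^^ k\<^sub>t) t = 1 \<and> (\<forall>k\<ge>k\<^sub>t. (T_map ^^ k) t = 1)))"
  using conjugacy_T_map_bcf_map preserves_measure_T_map emeasure_T_measure_space
    T_map_eventually_one by blast

end
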